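(* Let $(X,\mu)$ be a probability space and let $f_T$, $T\in\mathscr{T}_d$, be positive measurable functions on $X$. Suppose that there exist $a,c>0$ and $b\ge0$ such that for every sequence $(\Delta_n)$ of finite subsets of $\mathscr{T}_d$ satisfying $$|\Delta_n|\to\infty\quad\text{and}\quad\frac{\min_{T\ne T'\in\Delta_n}\max_p|\log T_p-\log T'_p|}{\log|\Delta_n|}\to\infty,$$ the minima $\mathfrak{M}_{\Delta_n}:=\min\{f_T:T\in\Delta_n\}$ satisfy $$|\Delta_n|^a(\log|\Delta_n|)^b\cdot\mathfrak{M}_{\Delta_n}\Longrightarrow\mathrm{Wei}(c,a)$$ in distribution with respect to $\mu$ as $n\to\infty$. Then for every $\delta<d-1$ and $\mu$-almost every $x\in X$, $$\liminf_{T\in\mathscr{T}_d,\ \|T\|_\infty\to\infty}(\log\|T\|_\infty)^{a\delta}f_T(x)=0.$$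
   Context: $\mathscr{T}_d=\{T=(T_1,\ldots,T_d):T_p>0,\ T_1\cdots T_d=1\}$, where $d\ge2$, and $\|T\|_\infty=\max_pT_p$. $\mathrm{Wei}(c,a)$ denotes the Weibull distribution, with distribution function $1-\exp(-(ct)^a)$ for $t\ge0$. *)

theory Defs
  imports "HOL-Probability.Probability" "HOL-Real_Asymp.Real_Asymp"
begin

definition unit_prods :: "(real ^ 'd) set" where
  "unit_prods = {T. (\<forall>p. T $ p > 0) \<and> (\<Prod>p\<in>UNIV. T $ p) = 1}"

text \<open>No absolute values: only used for vectors with positive coordinates.\<close>

definition sup_norm :: "real ^ 'd \<Rightarrow> real" where
  "sup_norm T = (MAX p. T $ p)"

definition log_dist :: "real ^ 'd \<Rightarrow> real ^ 'd \<Rightarrow> real" where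
  "log_dist T T' = (MAX p. \<bar>ln (T $ p) - ln (T' $ p)\<bar>)"

text \<open>The value for sets with fewer than two elements is irrelevant: it is only used along
  sequences of sets whose cardinality tends to infinity.\<close>

definition min_log_dist :: "(real ^ 'd) set \<Rightarrow> real" where
  "min_log_dist D = Min {log_dist T T' | T T'. T \<in> D \<and> T' \<in> D \<and> T \<noteq> T'}"

definition weibull_cdf :: "real \<Rightarrow> real \<Rightarrow> real \<Rightarrow> real" where
  "weibull_cdf c a t = (if t \<ge> 0 then 1 - exp (- ((c * t) powr a)) else 0)"

definition weibull :: "real \<Rightarrow> real \<Rightarrow> real measure" where
  "weibull c a = interval_measure (weibull_cdf c a)"

lemma weibull_cdf_mono:
  assumes "a > 0" "c > 0" "x \<le> y"
  shows "weibull_cdf c a x \<le> weibull_cdf c a y"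
  using assms by (auto simp: weibull_cdf_def intro!: powr_mono2 mult_left_mono)

lemma continuous_weibull_cdf:
  assumes "a > 0" "c > 0"
  shows "isCont (weibull_cdf c a) x"
proof -
  have eq: "weibull_cdf c a = (\<lambda>t. 1 - exp (- ((c * max 0 t) powr a)))"
    using assms by (auto simp: weibull_cdf_def fun_eq_iff max_def)
  have "continuous_on UNIV (\<lambda>t. 1 - exp (- ((c * max 0 t) powr a)))"
    using assms by (intro continuous_intros continuous_on_powr') auto
  then show ?thesis
    unfolding eq by (simp add: continuous_on_eq_continuous_at)
qed

lemma weibull_cdf_at_top:
  assumes "a > 0" "c > 0"
  shows "(weibull_cdf c a \<longlongrightarrow> 1) at_top"
proof -
  have "((\<lambda>t. 1 - exp (- ((c * t) powr a))) \<longlongrightarrow> 1) at_top"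
    using assms by real_asymp
  then show ?thesis
    by (rule Lim_transform_eventually)
      (auto simp: weibull_cdf_def eventually_at_top_linorder intro!: exI[of _ 0])
qed

lemma weibull_cdf_at_bot: "(weibull_cdf c a \<longlongrightarrow> 0) at_bot"
  by (rule tendsto_eventually)
    (auto simp: weibull_cdf_def eventually_at_bot_linorder intro!: exI[of _ "-1"])

lemma real_distribution_weibull:
  assumes "a > 0" "c > 0"
  shows "real_distribution (weibull c a)"
  unfolding weibull_def
  using weibull_cdf_mono continuous_weibull_cdf weibull_cdf_at_top weibull_cdf_at_bot assms
  by (intro real_distribution_interval_measure)
    (auto intro: continuous_at_imp_continuous_within)

lemma cdf_weibull:
  assumes "a > 0" "c > 0"
  shows "cdf (weibull c a) = weibull_cdf c a"
  unfolding weibull_def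
  using weibull_cdf_mono continuous_weibull_cdf weibull_cdf_at_top weibull_cdf_at_bot assms
  by (intro cdf_interval_measure)
    (auto intro: continuous_at_imp_continuous_within)

text \<open>The filter on \<^term>\<open>unit_prods\<close> of neighbourhoods of infinity, generated by the sets
  of \<open>T\<close> in \<^term>\<open>unit_prods\<close> whose sup norm is at least \<open>R\<close>.\<close>

definition at_inf_unit_prods :: "(real ^ 'd) filter" where
  "at_inf_unit_prods = inf (filtercomap sup_norm at_top) (principal unit_prods)"

lemma eventually_at_inf_unit_prods:
  "eventually P at_inf_unit_prods \<longleftrightarrow> (\<exists>R. \<forall>T\<in>unit_prods. sup_norm T \<ge> R \<longrightarrow> P T)"
  unfolding at_inf_unit_prods_def eventually_inf_principal
  by (force simp: eventually_filtercomap eventually_at_top_linorder)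

end

theory Submission
  imports Defs
begin

text \<open>In logarithmic coordinates \<^term>\<open>unit_prods\<close> is a hyperplane of dimension \<open>d - 1\<close>. A grid in it
  of mesh \<open>(ln N)\<^sup>2\<close> with \<open>N ^ (d - 1)\<close> points satisfies the separation condition, although its
  points have \<open>ln \<parallel>T\<parallel>\<close> at most \<open>N (ln N)\<^sup>2\<close>. By hypothesis the minimum of \<open>f T\<close> over the grid is at most
  of order \<open>N powr (- a * (d - 1))\<close> in probability, which beats \<open>(ln \<parallel>T\<parallel>) powr (a * \<delta>)\<close>.\<close>

section \<open>Weak convergence with normalisation tending to 0\<close>

text \<open>Weak convergence makes \<open>Y n\<close> bounded in probability, so \<open>w n * Y n \<ge> e\<close> holds with
  probability tending to 0, and the event that it holds for all large \<open>n\<close> is null.\<close>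

lemma (in prob_space) AE_frequently_mult_less:
  fixes Y :: "nat \<Rightarrow> 'a \<Rightarrow> real" and w :: "nat \<Rightarrow> real"
  assumes [measurable]: "\<And>n. Y n \<in> borel_measurable M"
    and N: "real_distribution N"
    and conv: "weak_conv_m (\<lambda>n. distr M borel (Y n)) N"
    and w: "w \<longlonglongrightarrow> 0" "\<And>n. w n \<ge> 0"
  shows "AE x in M. \<forall>e>0. \<exists>\<^sub>F n in sequentially. w n * Y n x < e"
proof -
  interpret N: real_distribution N by fact
  \<comment> \<open>Fixing \<open>e\<close> and \<open>m\<close> isolates one null event; countably
    many of these suffice for the conclusion.\<close>
  have null: "AE x in M. \<not> (\<forall>n\<ge>m. e \<le> w n * Y n x)" if "e > 0" for e m
  proof -
    define B where "B = {x \<in> space M. \<forall>n\<ge>m. e \<le> w n * Y n x}"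
    have [measurable]: "B \<in> sets M" unfolding B_def by measurable
    have "prob B \<le> \<eta>" if "\<eta> > 0" for \<eta>
    proof -
      have "eventually (\<lambda>K. cdf N K > 1 - \<eta>) at_top"
        using N.cdf_lim_at_top_prob \<open>\<eta> > 0\<close> by (intro order_tendstoD(1)) auto
      then obtain K0 where K0: "\<And>K. K \<ge> K0 \<Longrightarrow> cdf N K > 1 - \<eta>"
        by (auto simp: eventually_at_top_linorder)
      \<comment> \<open>Weak convergence controls the cdf only at continuity points of the limit.
        The atoms of \<open>N\<close> are countable, so any open interval contains a non-atom;
        \<open>K > 1\<close> permits division by \<open>K\<close>.\<close>
      obtain K where K: "K > max 1 K0" "isCont (cdf N) K"
      proof -
        have "uncountable ({max 1 K0<..<max 1 K0 + 1} - {x. measure N {x} \<noteq> 0})"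
          by (intro uncountable_minus_countable N.countable_support) (simp add: uncountable_open_interval)
        then obtain K where "K \<in> {max 1 K0<..<max 1 K0 + 1} - {x. measure N {x} \<noteq> 0}"
          by (metis all_not_in_conv countable_empty)
        then show ?thesis using that[of K] by (auto simp: N.isCont_cdf)
      qed
      have "(\<lambda>n. cdf (distr M borel (Y n)) K) \<longlonglongrightarrow> cdf N K"
        using conv K(2) by (auto simp: weak_conv_m_def weak_conv_def)
      then have "\<forall>\<^sub>F n in sequentially. cdf (distr M borel (Y n)) K > 1 - \<eta>"
        using K0[of K] K(1) by (intro order_tendstoD(1)) auto
      moreover have "\<forall>\<^sub>F n in sequentially. w n < e / K"
        using w(1) K(1) \<open>e > 0\<close> by (intro order_tendstoD(2)) auto
      ultimately have "\<forall>\<^sub>F n in sequentially.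
          n \<ge> m \<and> cdf (distr M borel (Y n)) K > 1 - \<eta> \<and> w n < e / K"
        using eventually_ge_at_top[of m] by eventually_elim auto
      then obtain n where n: "n \<ge> m" "cdf (distr M borel (Y n)) K > 1 - \<eta>" "w n < e / K"
        unfolding eventually_sequentially by blast
      define C where "C = {x \<in> space M. Y n x \<le> K}"
      have [measurable]: "C \<in> sets M" unfolding C_def by measurable
      have "cdf (distr M borel (Y n)) K = prob C"
        unfolding cdf_def C_def by (subst measure_distr) (auto intro!: arg_cong[of _ _ prob])
      have "w n * Y n x < e" if "x \<in> C" for x
      proof -
        have "w n * Y n x \<le> w n * K"
          using that w(2)[of n] by (intro mult_left_mono) (auto simp: C_def)
        also have "\<dots> < e" using n(3) K(1) by (simp add: field_simps)
        finally show ?thesis .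
      qed
      then have "B \<subseteq> space M - C"
        using n(1) unfolding B_def by (blast dest: leD)
      then have "prob B \<le> prob (space M - C)" by (intro finite_measure_mono) auto
      also have "\<dots> = 1 - prob C" by (rule prob_compl) auto
      also have "\<dots> \<le> \<eta>"
        using n(2) \<open>cdf (distr M borel (Y n)) K = prob C\<close> by simp
      finally show ?thesis .
    qed
    then have "prob B = 0"
      using field_le_epsilon[of "prob B" 0] by (simp add: measure_le_0_iff)
    then have "AE x in M. x \<notin> B"
      by (subst AE_iff_measurable[of B]) (auto simp: emeasure_eq_measure B_def)
    then show ?thesis by (rule AE_mp) (auto simp: B_def)
  qed
  \<comment> \<open>Taking \<open>e\<close> of the form 1 / (j + 1) keeps the union of null events
    countable.\<close>
  have "AE x in M. \<forall>j m. \<not> (\<forall>n\<ge>m. 1 / real (Suc j) \<le> w n * Y n x)"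
    unfolding AE_all_countable by (intro allI null) auto
  then show ?thesis
  proof (rule AE_mp, intro AE_I2 impI allI)
    fix x and e :: real
    assume x: "\<forall>j m. \<not> (\<forall>n\<ge>m. 1 / real (Suc j) \<le> w n * Y n x)" and "e > 0"
    then obtain j where j: "1 / real (Suc j) < e"
      using nat_approx_posE by blast
    show "\<exists>\<^sub>F n in sequentially. w n * Y n x < e"
      unfolding frequently_sequentially
    proof
      fix m
      obtain n where "n \<ge> m" "w n * Y n x < 1 / real (Suc j)" using x by (force simp: not_le)
      then show "\<exists>n\<ge>m. w n * Y n x < e" using j by (meson less_trans)
    qed
  qed
qed

section \<open>Grids in logarithmic coordinates\<close>

text \<open>The coordinates other than \<open>p0\<close> are free; the exponent at \<open>p0\<close>
  is chosen so that all exponents sum to 0, which makes the product 1.\<close>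

definition grid_point :: "'d \<Rightarrow> real \<Rightarrow> ('d \<Rightarrow> nat) \<Rightarrow> real ^ 'd" where
  "grid_point p0 s k =
    (\<chi> p. exp (s * (if p = p0 then - (\<Sum>q\<in>UNIV - {p0}. real (k q)) else real (k p))))"

text \<open>Extensional functions off \<open>p0\<close> correspond exactly to the free coordinates.
  Starting at 1 rather than 0 keeps every point far out, with norm at least
  \<open>exp s\<close>.\<close>

definition grid :: "'d \<Rightarrow> real \<Rightarrow> nat \<Rightarrow> (real ^ 'd) set" where
  "grid p0 s N = grid_point p0 s ` ((UNIV - {p0}) \<rightarrow>\<^sub>E {1..N})"

lemma finite_grid: "finite (grid p0 s N)"
  unfolding grid_def by (intro finite_imageI finite_PiE) auto

lemma grid_point_in_unit_prods: "grid_point p0 s k \<in> unit_prods"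
proof -
  have "(\<Prod>p\<in>UNIV. grid_point p0 s k $ p) = exp (s * (\<Sum>p\<in>UNIV.
      if p = p0 then - (\<Sum>q\<in>UNIV - {p0}. real (k q)) else real (k p)))"
    by (simp add: grid_point_def sum_distrib_left exp_sum)
  also have "\<dots> = 1"
    by (subst sum.remove[of _ p0]) auto
  finally show ?thesis
    by (simp add: unit_prods_def) (simp add: grid_point_def)
qed

lemma grid_subset_unit_prods: "grid p0 s N \<subseteq> unit_prods"
  using grid_point_in_unit_prods by (auto simp: grid_def)

lemma sup_norm_pos:
  assumes "T \<in> unit_prods"
  shows "sup_norm T > 0"
proof -
  have "0 < T $ p" for p using assms by (simp add: unit_prods_def)
  also have "T $ p \<le> sup_norm T" for p unfolding sup_norm_def by (intro Max_ge) auto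
  finally show ?thesis .
qed

text \<open>Distinct extensional functions differ at some free coordinate, and there the logarithms
  are distinct integer multiples of \<open>s\<close>.\<close>

lemma log_dist_grid_point:
  assumes "s > 0" and k: "k \<in> (UNIV - {p0}) \<rightarrow>\<^sub>E A" "l \<in> (UNIV - {p0}) \<rightarrow>\<^sub>E A" and "k \<noteq> l"
  shows "s \<le> log_dist (grid_point p0 s k) (grid_point p0 s l)"
proof -
  obtain p where p: "p \<noteq> p0" "k p \<noteq> l p"
    using PiE_ext[OF k] \<open>k \<noteq> l\<close> by blast
  have "s * 1 \<le> s * \<bar>real (k p) - real (l p)\<bar>"
    using \<open>s > 0\<close> p(2) by (intro mult_left_mono) auto
  also have "\<dots> = \<bar>ln (grid_point p0 s k $ p) - ln (grid_point p0 s l $ p)\<bar>"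
    using \<open>s > 0\<close> p(1) by (simp add: grid_point_def abs_mult flip: right_diff_distrib)
  also have "\<dots> \<le> log_dist (grid_point p0 s k) (grid_point p0 s l)"
    unfolding log_dist_def by (intro Max_ge) auto
  finally show ?thesis by simp
qed

text \<open>Injectivity follows from separation: two indices with the same image would give points
  at distance 0.\<close>

lemma card_grid:
  assumes "s > 0"
  shows "card (grid p0 s N :: (real ^ 'd) set) = N ^ (CARD('d) - 1)"
proof -
  have "inj_on (grid_point p0 s) ((UNIV - {p0}) \<rightarrow>\<^sub>E {1..N})"
  proof (rule inj_onI, rule ccontr)
    fix k l :: "'d \<Rightarrow> nat"
    assume kl: "k \<in> (UNIV - {p0}) \<rightarrow>\<^sub>E {1..N}" "l \<in> (UNIV - {p0}) \<rightarrow>\<^sub>E {1..N}"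
      and eq: "grid_point p0 s k = grid_point p0 s l" and "k \<noteq> l"
    have "s \<le> log_dist (grid_point p0 s k) (grid_point p0 s l)"
      by (rule log_dist_grid_point) fact+
    also have "\<dots> = 0" by (simp add: eq log_dist_def)
    finally show False using \<open>s > 0\<close> by simp
  qed
  then show ?thesis
    unfolding grid_def by (simp add: card_image card_funcsetE card_Diff_singleton)
qed

lemma min_log_dist_grid:
  assumes "s > 0" "card (grid p0 s N) \<ge> 2"
  shows "s \<le> min_log_dist (grid p0 s N)"
  unfolding min_log_dist_def
proof (rule Min.boundedI)
  let ?D = "grid p0 s N"
  let ?S = "{log_dist T T' |T T'. T \<in> ?D \<and> T' \<in> ?D \<and> T \<noteq> T'}"
  have "?S \<subseteq> (\<lambda>(T, T'). log_dist T T') ` (?D \<times> ?D)" by auto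
  then show "finite ?S" by (rule finite_subset) (simp add: finite_grid)
  \<comment> \<open>This is where at least two points are required: \<open>Min\<close> of the empty
    set is unspecified.\<close>
  show "?S \<noteq> {}"
    using assms(2) card_le_Suc0_iff_eq[OF finite_grid[of p0 s N]] by fastforce
  show "s \<le> r" if "r \<in> ?S" for r
  proof -
    obtain k l where k: "k \<in> (UNIV - {p0}) \<rightarrow>\<^sub>E {1..N}" "l \<in> (UNIV - {p0}) \<rightarrow>\<^sub>E {1..N}"
      and r: "r = log_dist (grid_point p0 s k) (grid_point p0 s l)"
      and ne: "grid_point p0 s k \<noteq> grid_point p0 s l"
    proof -
      from \<open>r \<in> ?S\<close> obtain T T' where "r = log_dist T T'" "T \<in> ?D" "T' \<in> ?D" "T \<noteq> T'" by blast
      then show ?thesis unfolding grid_def by (elim imageE) (use that in simp)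
    qed
    have "k \<noteq> l" using ne by auto
    then show ?thesis unfolding r by (rule log_dist_grid_point[OF \<open>s > 0\<close> k])
  qed
qed

text \<open>A free coordinate, which exists since the dimension is at least 2, has exponent at least
  \<open>s\<close>. No exponent exceeds \<open>s * real N\<close>, the one at \<open>p0\<close>
  being nonpositive.\<close>

lemma ln_sup_norm_grid:
  fixes T :: "real ^ 'd"
  assumes "CARD('d) \<ge> 2" "s > 0" "T \<in> grid p0 s N"
  shows "s \<le> ln (sup_norm T)" "ln (sup_norm T) \<le> s * real N"
proof -
  obtain k where k: "k \<in> (UNIV - {p0}) \<rightarrow>\<^sub>E {1..N}" and T: "T = grid_point p0 s k"
    using assms(3) by (auto simp: grid_def)
  have kp: "1 \<le> k p" "k p \<le> N" if "p \<noteq> p0" for p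
    using PiE_mem[OF k, of p] that by auto
  have "UNIV \<noteq> {p0}"
  proof
    assume "UNIV = {p0}"
    then have "CARD('d) = card {p0}" by (rule arg_cong)
    then show False using assms(1) by simp
  qed
  then obtain p where p: "p \<noteq> p0" by blast
  have "exp s \<le> T $ p"
    using kp[OF p] p \<open>s > 0\<close> by (simp add: T grid_point_def)
  also have "\<dots> \<le> sup_norm T" unfolding sup_norm_def by (intro Max_ge) auto
  finally have lower: "exp s \<le> sup_norm T" .
  then show "s \<le> ln (sup_norm T)"
    by (subst ln_ge_iff) (auto intro: less_le_trans[OF exp_gt_zero])
  have "sup_norm T \<le> exp (s * real N)"
    unfolding sup_norm_def
  proof (rule Max.boundedI; clarsimp)
    fix q
    show "T $ q \<le> exp (s * real N)"
    proof (cases "q = p0")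
      case True
      have "- (\<Sum>q\<in>UNIV - {p0}. real (k q)) \<le> real N"
        by (rule order_trans[of _ 0]) (auto intro: sum_nonneg)
      then have "s * - (\<Sum>q\<in>UNIV - {p0}. real (k q)) \<le> s * real N"
        using \<open>s > 0\<close> by (intro mult_left_mono) auto
      then show ?thesis using True by (simp add: T grid_point_def)
    qed (use kp[of q] \<open>s > 0\<close> in \<open>simp add: T grid_point_def\<close>)
  qed
  moreover have "0 < sup_norm T" using assms(3) grid_subset_unit_prods by (blast intro: sup_norm_pos)
  ultimately show "ln (sup_norm T) \<le> s * real N"
    by (metis ln_exp ln_mono exp_gt_zero)
qed

section \<open>The lower limit along the grids\<close>

text \<open>If the lower limit were positive, a real \<open>e\<close> strictly between 0 and it
  would eventually lie below \<open>g\<close>, against the second assumption.\<close>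

lemma Liminf_eq_0I:
  fixes g :: "'b \<Rightarrow> real"
  assumes "eventually (\<lambda>x. 0 \<le> g x) F" "\<And>e. e > 0 \<Longrightarrow> \<exists>\<^sub>F x in F. g x < e"
  shows "Liminf F (\<lambda>x. ereal (g x)) = 0"
proof (rule antisym)
  show "0 \<le> Liminf F (\<lambda>x. ereal (g x))"
    using assms(1) by (intro Liminf_bounded) (auto elim: eventually_mono)
  show "Liminf F (\<lambda>x. ereal (g x)) \<le> 0"
  proof (rule ccontr)
    assume "\<not> Liminf F (\<lambda>x. ereal (g x)) \<le> 0"
    then obtain e where e: "0 < ereal e" "ereal e < Liminf F (\<lambda>x. ereal (g x))"
      using ereal_dense2 by (metis not_le)
    then have "\<forall>\<^sub>F x in F. e < g x" by (auto dest: less_LiminfD)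
    moreover have "\<exists>\<^sub>F x in F. g x < e" using assms(2) e(1) by simp
    ultimately have "\<exists>\<^sub>F x in F. g x < e \<and> e < g x" by (metis frequently_eventually_frequently)
    then show False by (auto dest: frequently_ex)
  qed
qed

theorem propositionA1:
  fixes M :: "'x measure"
    and f :: "real ^ 'd \<Rightarrow> 'x \<Rightarrow> real"
    and a b c \<delta> :: real
  assumes d: "CARD('d) \<ge> 2"
    and M: "prob_space M"
    and meas: "\<And>T. T \<in> unit_prods \<Longrightarrow> f T \<in> borel_measurable M"
    and pos: "\<And>T x. T \<in> unit_prods \<Longrightarrow> x \<in> space M \<Longrightarrow> f T x > 0"
    and a: "a > 0" and c: "c > 0" and b: "b \<ge> 0"
    and conv: "\<And>\<Delta> :: nat \<Rightarrow> (real ^ 'd) set.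
      (\<And>n. finite (\<Delta> n)) \<Longrightarrow> (\<And>n. \<Delta> n \<subseteq> unit_prods) \<Longrightarrow>
      filterlim (\<lambda>n. card (\<Delta> n)) at_top sequentially \<Longrightarrow>
      filterlim (\<lambda>n. min_log_dist (\<Delta> n) / ln (real (card (\<Delta> n)))) at_top sequentially \<Longrightarrow>
      weak_conv_m
        (\<lambda>n. distr M borel
          (\<lambda>x. real (card (\<Delta> n)) powr a * ln (real (card (\<Delta> n))) powr b
            * (MIN T\<in>\<Delta> n. f T x)))
        (weibull c a)"
    and \<delta>: "\<delta> < real CARD('d) - 1"
  shows "AE x in M.
    Liminf at_inf_unit_prods (\<lambda>T. ereal (ln (sup_norm T) powr (a * \<delta>) * f T x)) = 0"
proof -
  interpret prob_space M by fact
  define p0 :: 'd where "p0 = undefined"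
  define m where "m = CARD('d) - 1"
  have m: "m \<ge> 1" "real CARD('d) - 1 = real m" using d by (auto simp: m_def)
  \<comment> \<open>A nonnegative exponent makes the power monotone in its base, so upper bounds on
    \<open>ln (sup_norm T)\<close> can be used.\<close>
  define \<delta>' where "\<delta>' = max \<delta> 0"
  have \<delta>': "\<delta> \<le> \<delta>'" "0 \<le> \<delta>'" "\<delta>' < real m" using \<delta> m by (auto simp: \<delta>'_def)
  \<comment> \<open>The shift by 3 > e gives \<open>ln (real (N n)) \<ge> 1\<close>.\<close>
  define N where "N n = n + 3" for n :: nat
  \<comment> \<open>One factor \<open>ln N\<close> is consumed by \<open>ln (card (D n))\<close>,
    which is \<open>m * ln N\<close>; the other sends the separation ratio to infinity.\<close>
  define s where "s n = ln (real (N n)) ^ 2" for n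
  define D where "D n = grid p0 (s n) (N n)" for n
  define Y where "Y n x = real (card (D n)) powr a * ln (real (card (D n))) powr b
    * (MIN T\<in>D n. f T x)" for n x
  \<comment> \<open>The numerator bounds \<open>ln (sup_norm T) powr (a * \<delta>')\<close> on the
    grid; the denominator is the factor \<open>card (D n) powr a\<close> in
    \<open>Y n\<close>.\<close>
  define w where "w n = (s n * real (N n)) powr (a * \<delta>') / real (N n) powr (a * real m)" for n
  have ln_N: "ln (real (N n)) \<ge> 1" for n
  proof -
    have "exp 1 \<le> real (N n)" using exp_le by (simp add: N_def)
    then show ?thesis by (subst ln_ge_iff) (auto simp: N_def)
  qed
  then have s1: "s n \<ge> 1" for n by (simp add: s_def)
  then have s_pos: "s n > 0" for n by (rule less_le_trans[OF zero_less_one])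
  have card_D: "card (D n) = N n ^ m" for n
    using card_grid[OF s_pos[of n], of p0 "N n"] by (simp add: D_def m_def)
  have card_D_ge: "card (D n) \<ge> N n" for n
    using m(1) by (simp add: card_D N_def self_le_power)
  have ln_card_D: "ln (real (card (D n))) = real m * ln (real (N n))" for n
    by (simp add: card_D N_def ln_realpow)
  have D_sub: "D n \<subseteq> unit_prods" for n by (simp add: D_def grid_subset_unit_prods)
  have D_fin: "finite (D n)" for n by (simp add: D_def finite_grid)
  have D_ne: "D n \<noteq> {}" for n using card_D_ge[of n] by (auto simp: N_def)
  have Y_meas: "Y n \<in> borel_measurable M" for n
    unfolding Y_def[abs_def] using D_fin D_sub meas
    by (intro borel_measurable_times borel_measurable_const borel_measurable_Min) auto
  have "weak_conv_m (\<lambda>n. distr M borel (Y n)) (weibull c a)"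
    unfolding Y_def
  proof (rule conv)
    have "filterlim N at_top sequentially" unfolding N_def by real_asymp
    then show "filterlim (\<lambda>n. card (D n)) at_top sequentially"
      by (rule filterlim_at_top_mono) (simp add: card_D_ge)
    have lim: "filterlim (\<lambda>n. ln (real (N n)) / real m) at_top sequentially"
      using m(1) unfolding N_def by real_asymp
    have le: "ln (real (N n)) / real m \<le> min_log_dist (D n) / ln (real (card (D n)))" for n
    proof -
      have "s n \<le> min_log_dist (D n)"
        unfolding D_def using s_pos card_D_ge[of n] by (intro min_log_dist_grid) (auto simp: D_def N_def)
      then have "s n / (real m * ln (real (N n))) \<le> min_log_dist (D n) / (real m * ln (real (N n)))"
        using ln_N[of n] by (intro divide_right_mono) auto
      then show ?thesis
        using ln_N[of n] by (simp add: ln_card_D s_def power2_eq_square)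
    qed
    show "filterlim (\<lambda>n. min_log_dist (D n) / ln (real (card (D n)))) at_top sequentially"
      by (rule filterlim_at_top_mono[OF lim always_eventually]) (simp add: le)
  qed (use D_fin D_sub in auto)
  \<comment> \<open>The power of \<open>N\<close> in \<open>w\<close> is
    \<open>a * (\<delta>' - m) < 0\<close>, and the remaining factor is only a power of
    \<open>ln N\<close>.\<close>
  moreover have "w \<longlonglongrightarrow> 0"
  proof -
    have "a * \<delta>' < a * real m" "0 \<le> a * \<delta>'" using a \<delta>' by auto
    then show ?thesis unfolding w_def s_def N_def
      by real_asymp
  qed
  moreover have "w n \<ge> 0" for n by (simp add: w_def)
  ultimately have "AE x in M. \<forall>e>0. \<exists>\<^sub>F n in sequentially. w n * Y n x < e"
    using Y_meas real_distribution_weibull[OF a c] by (intro AE_frequently_mult_less)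
  then show ?thesis
  proof (rule AE_mp, intro AE_I2 impI)
    fix x assume x: "x \<in> space M" and freq: "\<forall>e>0. \<exists>\<^sub>F n in sequentially. w n * Y n x < e"
    have "filterlim s at_top sequentially" unfolding s_def N_def by real_asymp
    show "Liminf at_inf_unit_prods (\<lambda>T. ereal (ln (sup_norm T) powr (a * \<delta>) * f T x)) = 0"
    proof (rule Liminf_eq_0I)
      show "\<forall>\<^sub>F T in at_inf_unit_prods. 0 \<le> ln (sup_norm T) powr (a * \<delta>) * f T x"
        using pos x by (auto simp: eventually_at_inf_unit_prods less_imp_le)
    next
      fix e :: real assume "e > 0"
      have "\<exists>T\<in>unit_prods. R \<le> sup_norm T \<and> ln (sup_norm T) powr (a * \<delta>) * f T x < e" for R
      proof -
        have "\<forall>\<^sub>F n in sequentially. R \<le> s n"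
          using \<open>filterlim s at_top sequentially\<close> by (simp add: filterlim_at_top)
        then have "\<exists>\<^sub>F n in sequentially. w n * Y n x < e \<and> R \<le> s n"
          using freq \<open>e > 0\<close> by (intro frequently_eventually_frequently) auto
        then obtain n where n: "w n * Y n x < e" "R \<le> s n" by (auto dest: frequently_ex)
        \<comment> \<open>The finite minimum is attained at a point depending on \<open>x\<close>
          and \<open>n\<close>; this is the required \<open>T\<close>.\<close>
        obtain T where T: "T \<in> D n" "(MIN T\<in>D n. f T x) = f T x"
          using Min_in[of "(\<lambda>T. f T x) ` D n"] D_fin[of n] D_ne[of n]
          by (metis empty_is_image finite_imageI imageE)
        have L: "s n \<le> ln (sup_norm T)" "ln (sup_norm T) \<le> s n * real (N n)"
          using ln_sup_norm_grid[OF d s_pos] T(1) by (auto simp: D_def)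
        have "f T x > 0" using pos T(1) D_sub x by blast
        \<comment> \<open>Raising the exponent is allowed because the base is at least
          \<open>s n \<ge> 1\<close>.\<close>
        have "ln (sup_norm T) powr (a * \<delta>) \<le> ln (sup_norm T) powr (a * \<delta>')"
          using L(1) s1[of n] a \<delta>' by (intro powr_mono) auto
        also have "\<dots> \<le> (s n * real (N n)) powr (a * \<delta>')"
          using L s_pos[of n] a \<delta>' by (intro powr_mono2) auto
        also have "\<dots> = w n * (real (card (D n)) powr a * 1)"
          by (simp add: w_def card_D N_def powr_powr mult.commute flip: powr_realpow)
        \<comment> \<open>The logarithmic factor of the normalisation is at least 1, as
          \<open>b \<ge> 0\<close> and \<open>ln (card (D n)) \<ge> 1\<close>.\<close>
        also have "\<dots> \<le> w n * (real (card (D n)) powr a * ln (real (card (D n))) powr b)"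
        proof -
          have "1 * 1 \<le> real m * ln (real (N n))" using m(1) ln_N by (intro mult_mono) auto
          then show ?thesis
            using b \<open>w n \<ge> 0\<close> by (intro mult_left_mono ge_one_powr_ge_zero) (auto simp: ln_card_D)
        qed
        finally have "ln (sup_norm T) powr (a * \<delta>) * f T x \<le> w n * Y n x"
          using \<open>f T x > 0\<close> unfolding Y_def T(2) mult.assoc[symmetric]
          by (intro mult_right_mono) auto
        moreover have "R \<le> sup_norm T"
        proof -
          have "sup_norm T > 0" using T(1) D_sub[of n] by (intro sup_norm_pos) auto
          \<comment> \<open>\<open>R\<close> is below \<open>s n\<close>, hence below
            \<open>ln (sup_norm T)\<close>, which is less than \<open>sup_norm T\<close>.\<close>
          then show ?thesis using L(1) n(2) ln_le_minus_one[of "sup_norm T"] by linarith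
        qed
        ultimately show ?thesis using T(1) D_sub n(1) by fastforce
      qed
      then show "\<exists>\<^sub>F T in at_inf_unit_prods. ln (sup_norm T) powr (a * \<delta>) * f T x < e"
        unfolding frequently_def eventually_at_inf_unit_prods by blast
    qed
  qed
qed

end
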